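(* Let $X$ and $Y$ be separable Hilbert spaces, let $Q$ be a self-adjoint, positive, trace class operator on $Y$, let $(\lambda_k, e_k)_{k\in\mathbb{N}}$ denote an eigensystem of $Q$, and let the forward mapping $F: X \to Y$ satisfy one of the following two conditions: (i) there exists $C > 0$ such that $$\sum_{k=1}^\infty \frac{|(F(x_1) - F(x_2), e_k)_Y|}{\lambda_k^{1/2}} \le C\|x_1 - x_2\|_X \quad \text{for all } x_1, x_2 \in X;$$ or (ii) $F$ is Fréchet differentiable and there exists $C > 0$ such that $$\sum_{k=1}^\infty \frac{\|F'(x)^*e_k\|_X}{\lambda_k^{1/2}} \le C \quad \text{for all } x \in X.$$ Then $\Phi: X \times Y \to \mathbb{R}$, given by $$\Phi(u,y) = \sqrt{2}\sum_{k=1}^\infty \frac{|(y - F(u), e_k)_Y| - |(y,e_k)_Y|}{\lambda_k^{1/2}},$$ is Lipschitz continuous in $u$ for all $y \in Y$. In particular, for every $y \in Y$, $\Phi(\cdot,y)$ is Lipschitz continuous on bounded sets and there exists $\underline{L} \ge 0$ such that $\Phi(u,y) \ge \Phi(0,y) - \underline{L}\|u\|_X$ for all $u \in X$.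
   Context: An eigensystem $(\lambda_k,e_k)_{k\in\mathbb{N}}$ of $Q$ consists of an orthonormal basis $(e_k)_{k\in\mathbb{N}}$ of $Y$ with $Qe_k = \lambda_k e_k$, $\lambda_k > 0$. $F'(x)^*$ is the adjoint of the Fréchet derivative of $F$ at $x$. "Lipschitz continuous on bounded sets" means: for every $r > 0$ there is $L = L(r) > 0$ that is a Lipschitz constant on the open ball $B_r(0)$ of radius $r$ around $0$ in $X$. The function $\Phi$ is the negative log-likelihood for the inverse problem $y = F(u) + \eta$ with additive Laplacian noise $\eta = \sum_k \eta_k e_k$, where the $\eta_k$ are independent centered real Laplace random variables with variances $\lambda_k$.
   Formalization: The series for Φ(u,y) need not converge (F constant equal to a with Σ|(a,e_k)|/λ_k^{1/2} = ∞, y = 0), so Φ need not be real-valued; it is shown instead that convergence at one u gives convergence at all u, and the Lipschitz claims have content for those y. *)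

theory Defs
  imports "HOL-Analysis.Analysis"
begin

text \<open>
  Real Hilbert spaces are types of the classes \<open>real_inner\<close> and \<open>complete_space\<close>. Every bounded
  linear operator between such spaces has exactly one adjoint, so the library's \<open>adjoint\<close>, defined
  by Hilbert choice, is the Hilbert space adjoint.
\<close>

definition self_adjoint :: "('a::real_inner \<Rightarrow> 'a) \<Rightarrow> bool" where
  "self_adjoint T \<longleftrightarrow> bounded_linear T \<and> (\<forall>x y. T x \<bullet> y = x \<bullet> T y)"

definition positive_operator :: "('a::real_inner \<Rightarrow> 'a) \<Rightarrow> bool" where
  "positive_operator T \<longleftrightarrow> bounded_linear T \<and> (\<forall>x. 0 \<le> T x \<bullet> x)"

definition orthonormal_basis :: "'a::real_inner set \<Rightarrow> bool" where
  "orthonormal_basis B \<longleftrightarrow>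
     pairwise orthogonal B \<and> (\<forall>b\<in>B. norm b = 1) \<and> closure (span B) = UNIV"

text \<open>
  \<open>T\<close> is trace class if its absolute value \<open>P = (T\<^sup>* T)\<^sup>1\<^sup>/\<^sup>2\<close>, the unique positive self-adjoint square
  root of \<open>T\<^sup>* T\<close>, has finite trace. The trace of a positive operator does not depend on the
  orthonormal basis used to compute it.
\<close>

definition trace_class :: "('a::{real_inner,complete_space} \<Rightarrow> 'a) \<Rightarrow> bool" where
  "trace_class T \<longleftrightarrow> bounded_linear T \<and>
     (\<exists>P. self_adjoint P \<and> positive_operator P \<and> P \<circ> P = adjoint T \<circ> T \<and>
        (\<exists>B. orthonormal_basis B \<and> (\<lambda>b. P b \<bullet> b) summable_on B))"

definition eigensystem ::
    "('a::real_inner \<Rightarrow> 'a) \<Rightarrow> (nat \<Rightarrow> real) \<Rightarrow> (nat \<Rightarrow> 'a) \<Rightarrow> bool" where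
  "eigensystem Q lam e \<longleftrightarrow>
     inj e \<and> orthonormal_basis (range e) \<and> (\<forall>k. Q (e k) = lam k *\<^sub>R e k \<and> 0 < lam k)"

definition Phi_term ::
    "(nat \<Rightarrow> real) \<Rightarrow> (nat \<Rightarrow> 'y::real_inner) \<Rightarrow> ('x \<Rightarrow> 'y) \<Rightarrow> 'x \<Rightarrow> 'y \<Rightarrow> nat \<Rightarrow> real" where
  "Phi_term lam e F u y k = (\<bar>(y - F u) \<bullet> e k\<bar> - \<bar>y \<bullet> e k\<bar>) / sqrt (lam k)"

text \<open>
  The series need not converge under \<open>weighted_lipschitz\<close> or \<open>weighted_derivative_bound\<close> below, since
  neither controls \<open>F\<close> at a single point: both allow \<open>F\<close> to be constantly \<open>a\<close> with
  \<open>\<Sum>k. \<bar>a \<bullet> e k\<bar> / sqrt (lam k)\<close> divergent, and then the series diverges at \<open>y = 0\<close>. As always with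
  \<open>suminf\<close>, the value of \<open>Phi\<close> is meaningful only where the series converges.
\<close>

definition Phi ::
    "(nat \<Rightarrow> real) \<Rightarrow> (nat \<Rightarrow> 'y::real_inner) \<Rightarrow> ('x \<Rightarrow> 'y) \<Rightarrow> 'x \<Rightarrow> 'y \<Rightarrow> real" where
  "Phi lam e F u y = sqrt 2 * (\<Sum>k. Phi_term lam e F u y k)"

text \<open>
  The bounds on infinite series include their convergence.
\<close>

definition weighted_lipschitz ::
    "(nat \<Rightarrow> real) \<Rightarrow> (nat \<Rightarrow> 'y::real_inner) \<Rightarrow> ('x::real_normed_vector \<Rightarrow> 'y) \<Rightarrow> bool" where
  "weighted_lipschitz lam e F \<longleftrightarrow>
     (\<exists>C>0. \<forall>x1 x2.
        summable (\<lambda>k. \<bar>(F x1 - F x2) \<bullet> e k\<bar> / sqrt (lam k)) \<and>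
        (\<Sum>k. \<bar>(F x1 - F x2) \<bullet> e k\<bar> / sqrt (lam k)) \<le> C * norm (x1 - x2))"

definition weighted_derivative_bound ::
    "(nat \<Rightarrow> real) \<Rightarrow> (nat \<Rightarrow> 'y::real_inner) \<Rightarrow> ('x::real_inner \<Rightarrow> 'y) \<Rightarrow> bool" where
  "weighted_derivative_bound lam e F \<longleftrightarrow>
     (\<forall>x. F differentiable (at x)) \<and>
     (\<exists>C>0. \<forall>x.
        summable (\<lambda>k. norm (adjoint (frechet_derivative F (at x)) (e k)) / sqrt (lam k)) \<and>
        (\<Sum>k. norm (adjoint (frechet_derivative F (at x)) (e k)) / sqrt (lam k)) \<le> C)"

end

theory Submission
  imports Defs
begin

text \<open>
  Condition (ii) implies (i): for every choice of signs \<open>s\<^sub>k\<close>, the mean value inequality applied to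
  \<open>x \<mapsto> \<Sum>k<n. s\<^sub>k (F x, e\<^sub>k) / sqrt \<lambda>\<^sub>k\<close>, whose derivative is bounded by \<open>C\<close>, bounds its increments by
  \<open>C \<parallel>x\<^sub>1 - x\<^sub>2\<parallel>\<close>, and the signs can be chosen to produce absolute values. Under (i), the reverse
  triangle inequality bounds the difference of the series defining \<open>\<Phi>(u, y)\<close> and \<open>\<Phi>(v, y)\<close> term by
  term, uniformly in \<open>y\<close>. If the series diverges at one \<open>u\<close> it diverges at all, and then \<open>suminf\<close>
  has the same junk value everywhere.
\<close>

text \<open>
  The representing vector is the minimiser of \<open>x \<mapsto> \<parallel>x\<parallel>\<^sup>2 / 2 - f x\<close>; by the parallelogram law,
  minimising sequences are Cauchy.
\<close>

lemma riesz_representation: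
  fixes f :: "'a::{real_inner,complete_space} \<Rightarrow> real"
  assumes f: "bounded_linear f"
  obtains z where "\<And>x. f x = x \<bullet> z"
proof -
  interpret bounded_linear f by (rule f)
  define J where "J x = (x \<bullet> x) / 2 - f x" for x
  obtain K where K: "\<And>x. norm (f x) \<le> norm x * K"
    using bounded by blast
  \<comment> \<open>Completing the square bounds \<open>J\<close> below, so its infimum
    \<open>m\<close> is a genuine one.\<close>
  have lower: "- (K\<^sup>2 / 2) \<le> J x" for x
  proof -
    have "f x \<le> norm x * K"
      using K[of x] by simp
    moreover have "0 \<le> (norm x - K)\<^sup>2"
      by simp
    ultimately show ?thesis
      by (simp add: J_def dot_square_norm power2_diff)
  qed
  define m where "m = (INF x. J x)"
  have bdd: "bdd_below (range J)"
    using lower by (auto intro!: bdd_belowI)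
  have m_le: "m \<le> J x" for x
    unfolding m_def by (rule cINF_lower[OF bdd]) simp
  have "\<exists>x. J x < m + inverse (real (Suc n))" for n
    using cINF_less_iff[of UNIV J "m + inverse (real (Suc n))"] bdd by (auto simp: m_def)
  then obtain X where X: "\<And>n. J (X n) < m + inverse (real (Suc n))"
    by metis
  \<comment> \<open>The linear part \<open>f\<close> cancels at the midpoint, which leaves the
    parallelogram law for the quadratic part.\<close>
  have parallelogram: "(norm (x - y))\<^sup>2 / 4 = J x + J y - 2 * J ((1/2) *\<^sub>R (x + y))" for x y
    by (simp add: J_def add scaleR power2_norm_eq_inner inner_diff_left inner_diff_right
        inner_add_left inner_add_right inner_commute field_simps)
  have close: "(norm (X i - X j))\<^sup>2 \<le> 4 * (inverse (real (Suc i)) + inverse (real (Suc j)))" for i j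
    using parallelogram[of "X i" "X j"] X[of i] X[of j] m_le[of "(1/2) *\<^sub>R (X i + X j)"]
    by argo
  have "Cauchy X"
  proof (rule metric_CauchyI)
    fix \<epsilon> :: real assume \<epsilon>: "0 < \<epsilon>"
    \<comment> \<open>With both reciprocals below a bound of \<open>\<epsilon>\<^sup>2 / 8\<close>,
      the factor 4 in \<open>close\<close> gives exactly \<open>\<epsilon>\<^sup>2\<close>.\<close>
    obtain N where N: "inverse (real (Suc N)) < \<epsilon>\<^sup>2 / 8"
      using reals_Archimedean[of "\<epsilon>\<^sup>2 / 8"] \<epsilon> by auto
    have "dist (X i) (X j) < \<epsilon>" if "N \<le> i" "N \<le> j" for i j
    proof -
      have "inverse (real (Suc i)) \<le> inverse (real (Suc N))"
        "inverse (real (Suc j)) \<le> inverse (real (Suc N))"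
        using that by (simp_all add: le_imp_inverse_le)
      then have "(norm (X i - X j))\<^sup>2 < \<epsilon>\<^sup>2"
        using close[of i j] N by argo
      then show ?thesis
        unfolding dist_norm using \<epsilon> by (auto intro: power2_less_imp_less)
    qed
    then show "\<exists>M. \<forall>i\<ge>M. \<forall>j\<ge>M. dist (X i) (X j) < \<epsilon>"
      by blast
  qed
  then obtain z where z: "X \<longlonglongrightarrow> z"
    using Cauchy_convergent convergent_def by blast
  have "(\<lambda>n. J (X n)) \<longlonglongrightarrow> J z"
    unfolding J_def by (intro tendsto_intros tendsto z) simp
  moreover have "(\<lambda>n. m + inverse (real (Suc n))) \<longlonglongrightarrow> m + 0"
    by (intro tendsto_intros LIMSEQ_inverse_real_of_nat)
  ultimately have "J z \<le> m + 0"
    by (rule LIMSEQ_le) (use X in \<open>auto intro: less_imp_le\<close>)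
  then have min: "J z \<le> J x" for x
    using m_le[of x] by simp
  have "f h = h \<bullet> z" for h
  proof -
    \<comment> \<open>\<open>a\<close> is the derivative of \<open>J\<close> at \<open>z\<close> in
      direction \<open>h\<close>. The step \<open>- a / d\<close> lowers \<open>J\<close> unless
      \<open>a\<close> vanishes; the added 1 in \<open>d\<close> keeps it well defined for
      \<open>h = 0\<close>.\<close>
    define a where "a = h \<bullet> z - f h"
    define d where "d = h \<bullet> h + 1"
    have d: "0 < d"
      by (simp add: d_def add_nonneg_pos)
    have line: "J (z + t *\<^sub>R h) = J z + t * a + t\<^sup>2 * (h \<bullet> h) / 2" for t
      by (simp add: J_def a_def add scaleR inner_add_left inner_add_right inner_commute
          power2_eq_square field_simps)
    have "0 \<le> (- a / d) * a + (- a / d)\<^sup>2 * (h \<bullet> h) / 2"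
      using min[of "z + (- a / d) *\<^sub>R h"] unfolding line by linarith
    also have "\<dots> = - (a\<^sup>2 * (d + 1)) / (2 * d\<^sup>2)"
    proof -
      have hh: "h \<bullet> h = d - 1"
        by (simp add: d_def)
      show ?thesis
        unfolding hh using d by (simp add: field_simps power2_eq_square)
    qed
    finally have "a\<^sup>2 * (d + 1) \<le> 0"
      using d by (simp add: divide_le_0_iff zero_le_divide_iff)
    then have "a = 0"
      using d by (simp add: mult_le_0_iff)
    then show ?thesis
      by (simp add: a_def)
  qed
  then show thesis
    by (rule that)
qed

text \<open>\<open>adjoint\<close> is a Hilbert choice, so its defining property holds once some
  adjoint exists; Riesz representation of the functional \<open>T _ \<bullet> y\<close> for each
  \<open>y\<close> supplies one.\<close>

lemma adjoint_bounded_linear: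
  fixes T :: "'a::{real_inner,complete_space} \<Rightarrow> 'b::real_inner"
  assumes "bounded_linear T"
  shows "T x \<bullet> y = x \<bullet> adjoint T y"
proof -
  have "\<exists>z. \<forall>x. T x \<bullet> y = x \<bullet> z" for y
    using riesz_representation[OF bounded_linear_compose[OF bounded_linear_inner_left assms]]
    by metis
  then have "\<exists>T'. \<forall>x y. T x \<bullet> y = x \<bullet> T' y"
    by metis
  then show ?thesis
    unfolding adjoint_def by (rule someI2_ex) blast
qed

lemma weighted_derivative_bound_imp_weighted_lipschitz:
  fixes F :: "'x::{real_inner,complete_space} \<Rightarrow> 'y::real_inner"
  assumes lam: "\<And>k. 0 < lam k" and F: "weighted_derivative_bound lam e F"
  shows "weighted_lipschitz lam e F"
proof -
  define D where "D x = frechet_derivative F (at x)" for x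
  define A where "A x k = norm (adjoint (D x) (e k)) / sqrt (lam k)" for x k
  obtain C where "0 < C" and A: "\<And>x. summable (A x)" "\<And>x. (\<Sum>k. A x k) \<le> C"
    using F unfolding weighted_derivative_bound_def A_def D_def by blast
  have D: "(F has_derivative D x) (at x)" for x
    using F by (simp add: weighted_derivative_bound_def D_def frechet_derivative_works)
  have sqrt_pos: "0 < sqrt (lam k)" for k
    using lam by simp
  \<comment> \<open>A bound on partial sums that is uniform in \<open>n\<close> yields both
    convergence and the bound on the series, and only finite sums have to be differentiated.\<close>
  have partial: "(\<Sum>k<n. \<bar>(F x1 - F x2) \<bullet> e k\<bar> / sqrt (lam k)) \<le> C * norm (x1 - x2)" for n x1 x2
  proof -
    \<comment> \<open>The signs are frozen at the pair \<open>x1\<close>, \<open>x2\<close>: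
      \<open>g\<close> is then differentiable everywhere, while its increment from \<open>x2\<close>
      to \<open>x1\<close> is still the sum of absolute values.\<close>
    define s where "s k = sgn ((F x1 - F x2) \<bullet> e k)" for k
    have s: "\<bar>s k\<bar> \<le> 1" for k
      by (simp add: s_def sgn_real_def)
    define g where "g x = (\<Sum>k<n. s k * (F x \<bullet> e k) / sqrt (lam k))" for x
    define g' where "g' x h = (\<Sum>k<n. s k * (D x h \<bullet> e k) / sqrt (lam k))" for x h
    have g': "(g has_derivative g' x) (at x)" for x
      unfolding g_def g'_def divide_inverse
      by (intro has_derivative_sum has_derivative_mult_left has_derivative_mult_right
          has_derivative_inner_left D)
    have bound: "norm (g' x h) \<le> C * norm h" for x h
    proof -
      have "norm (g' x h) \<le> (\<Sum>k<n. \<bar>s k * (D x h \<bullet> e k) / sqrt (lam k)\<bar>)"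
        unfolding g'_def real_norm_def by (rule sum_abs)
      also have "\<dots> \<le> (\<Sum>k<n. A x k * norm h)"
      proof (rule sum_mono)
        fix k
        have "\<bar>s k\<bar> * \<bar>D x h \<bullet> e k\<bar> \<le> \<bar>D x h \<bullet> e k\<bar>"
          using s by (intro mult_left_le_one_le) auto
        \<comment> \<open>Moving the derivative onto \<open>e k\<close> lets Cauchy-Schwarz split
          off \<open>norm h\<close>, a factor common to all \<open>k\<close>.\<close>
        also have "\<dots> = \<bar>h \<bullet> adjoint (D x) (e k)\<bar>"
          by (simp add: adjoint_bounded_linear[OF has_derivative_bounded_linear[OF D]])
        also have "\<dots> \<le> norm (adjoint (D x) (e k)) * norm h"
          using Cauchy_Schwarz_ineq2[of h "adjoint (D x) (e k)"] by (simp add: mult.commute)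
        finally show "\<bar>s k * (D x h \<bullet> e k) / sqrt (lam k)\<bar> \<le> A x k * norm h"
          using sqrt_pos[of k] by (simp add: A_def abs_mult divide_right_mono)
      qed
      also have "\<dots> \<le> C * norm h"
      proof -
        have "sum (A x) {..<n} \<le> suminf (A x)"
          using A(1) by (rule sum_le_suminf) (auto simp: A_def lam less_imp_le)
        then show ?thesis
          using A(2)[of x] by (simp flip: sum_distrib_right add: mult_right_mono)
      qed
      finally show ?thesis .
    qed
    have "norm (g x1 - g x2) \<le> C * norm (x1 - x2)"
    proof (rule differentiable_bound)
      show "(g has_derivative g' x) (at x within UNIV)" for x
        using g' by simp
      show "onorm (g' x) \<le> C" for x
        using \<open>0 < C\<close> bound by (intro onorm_bound) auto
    qed auto
    moreover have "g x1 - g x2 = (\<Sum>k<n. \<bar>(F x1 - F x2) \<bullet> e k\<bar> / sqrt (lam k))"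
      unfolding g_def sum_subtractf[symmetric]
    proof (rule sum.cong)
      fix k
      have "\<bar>(F x1 - F x2) \<bullet> e k\<bar> = s k * (F x1 \<bullet> e k) - s k * (F x2 \<bullet> e k)"
        unfolding s_def right_diff_distrib[symmetric] inner_diff_left[symmetric]
        by (simp add: abs_sgn mult.commute)
      then show "s k * (F x1 \<bullet> e k) / sqrt (lam k) - s k * (F x2 \<bullet> e k) / sqrt (lam k) =
          \<bar>(F x1 - F x2) \<bullet> e k\<bar> / sqrt (lam k)"
        by (simp add: diff_divide_distrib)
    qed simp
    ultimately show ?thesis
      by simp
  qed
  have nonneg: "0 \<le> \<bar>(F x1 - F x2) \<bullet> e k\<bar> / sqrt (lam k)" for x1 x2 k
    using sqrt_pos[of k] by simp
  have summable: "summable (\<lambda>k. \<bar>(F x1 - F x2) \<bullet> e k\<bar> / sqrt (lam k))" for x1 x2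
    using nonneg partial by (rule summableI_nonneg_bounded)
  show ?thesis
    unfolding weighted_lipschitz_def
    using \<open>0 < C\<close> summable suminf_le_const[OF summable partial] by blast
qed

text \<open>The subtracted \<open>\<bar>y \<bullet> e k\<bar>\<close> cancels, and the reverse
  triangle inequality removes the remaining \<open>y\<close>.\<close>

lemma abs_Phi_term_diff_le:
  assumes "0 < lam k"
  shows "\<bar>Phi_term lam e F u y k - Phi_term lam e F v y k\<bar> \<le> \<bar>(F u - F v) \<bullet> e k\<bar> / sqrt (lam k)"
proof -
  have "\<bar>\<bar>(y - F u) \<bullet> e k\<bar> - \<bar>(y - F v) \<bullet> e k\<bar>\<bar> \<le> \<bar>(F u - F v) \<bullet> e k\<bar>"
    by (simp add: inner_diff_left)
  then show ?thesis
    using assms by (simp add: Phi_term_def divide_right_mono flip: diff_divide_distrib)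
qed

text \<open>Both claims rest on one comparison: the termwise differences between \<open>u\<close>
  and \<open>v\<close> are absolutely summable, dominated by the series of the weighted Lipschitz
  condition.\<close>

lemma
  fixes F :: "'x::real_normed_vector \<Rightarrow> 'y::real_inner"
  assumes lam: "\<And>k. 0 < lam k" and F: "weighted_lipschitz lam e F"
  shows summable_Phi_term_transfer:
      "summable (Phi_term lam e F u y) \<Longrightarrow> summable (Phi_term lam e F v y)"
    and Phi_lipschitz: "\<exists>L. L-lipschitz_on UNIV (\<lambda>u. Phi lam e F u y)"
proof -
  define B where "B u v k = \<bar>(F u - F v) \<bullet> e k\<bar> / sqrt (lam k)" for u v k
  obtain C where "0 < C" and B: "\<And>u v. summable (B u v)"
      and C: "\<And>u v. suminf (B u v) \<le> C * norm (u - v)"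
    using F unfolding weighted_lipschitz_def B_def by blast
  have le: "norm (Phi_term lam e F u y k - Phi_term lam e F v y k) \<le> B u v k" for u v k
    unfolding B_def real_norm_def by (rule abs_Phi_term_diff_le[OF lam])
  have diff: "summable (\<lambda>k. norm (Phi_term lam e F u y k - Phi_term lam e F v y k))" for u v
    by (rule summable_comparison_test'[OF B[of u v]]) (use le in simp)
  show transfer: "summable (Phi_term lam e F v y)" if "summable (Phi_term lam e F u y)" for u v
    using summable_diff[OF that summable_norm_cancel[OF diff[of u v]]] by simp
  show "\<exists>L. L-lipschitz_on UNIV (\<lambda>u. Phi lam e F u y)"
  proof (cases "\<exists>u. summable (Phi_term lam e F u y)")
    case True
    then have s: "summable (Phi_term lam e F u y)" for u
      using transfer by blast
    have "\<bar>Phi lam e F u y - Phi lam e F v y\<bar> \<le> sqrt 2 * C * norm (u - v)" for u v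
    proof -
      have "\<bar>\<Sum>k. Phi_term lam e F u y k - Phi_term lam e F v y k\<bar> \<le>
          (\<Sum>k. norm (Phi_term lam e F u y k - Phi_term lam e F v y k))"
        using summable_norm[OF diff[of u v]] by simp
      also have "\<dots> \<le> suminf (B u v)"
        by (rule suminf_le[OF le diff B])
      also have "\<dots> \<le> C * norm (u - v)"
        by (rule C)
      finally show ?thesis
        by (simp add: Phi_def suminf_diff[OF s s, symmetric] abs_mult
            flip: right_diff_distrib)
    qed
    then show ?thesis
      using \<open>0 < C\<close> by (intro exI[of _ "sqrt 2 * C"] lipschitz_onI) (auto simp: dist_norm)
  next
    case False
    \<comment> \<open>\<open>suminf\<close> is a definite description over \<open>sums\<close>.
      Since that predicate is empty for every \<open>u\<close>, all values of \<open>Phi\<close> at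
      \<open>y\<close> coincide and 0 is a Lipschitz constant.\<close>
    then have "(sums) (Phi_term lam e F u y) = (\<lambda>_. False)" for u
      by (auto simp: summable_def)
    then have "Phi lam e F u y = Phi lam e F v y" for u v
      by (simp add: Phi_def suminf_def)
    then show ?thesis
      by (intro exI[of _ 0] lipschitz_onI) (auto simp: dist_norm)
  qed
qed

theorem proposition3p12:
  fixes Q :: "'y::{real_inner,complete_space} \<Rightarrow> 'y"
    and lam :: "nat \<Rightarrow> real"
    and e :: "nat \<Rightarrow> 'y"
    and F :: "'x::{real_inner,complete_space} \<Rightarrow> 'y"
  assumes "separable_space (euclidean :: 'x topology)"
    and "separable_space (euclidean :: 'y topology)"
    and "self_adjoint Q" and "positive_operator Q" and "trace_class Q"
    and "eigensystem Q lam e"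
    and "weighted_lipschitz lam e F \<or> weighted_derivative_bound lam e F"
  shows "\<forall>y.
      ((\<exists>u. summable (Phi_term lam e F u y)) \<longrightarrow> (\<forall>u. summable (Phi_term lam e F u y))) \<and>
      (\<exists>L. L-lipschitz_on UNIV (\<lambda>u. Phi lam e F u y)) \<and>
      (\<forall>r>0. \<exists>L>0. L-lipschitz_on (ball 0 r) (\<lambda>u. Phi lam e F u y)) \<and>
      (\<exists>L\<ge>0. \<forall>u. Phi lam e F u y \<ge> Phi lam e F 0 y - L * norm u)"
proof (intro allI conjI impI)
  fix y
  have lam: "\<And>k. 0 < lam k"
    using assms(6) by (simp add: eigensystem_def)
  have F: "weighted_lipschitz lam e F"
    using assms(7) weighted_derivative_bound_imp_weighted_lipschitz[of lam, OF lam] by blast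
  show "summable (Phi_term lam e F u y)" if "\<exists>u. summable (Phi_term lam e F u y)" for u
    using that summable_Phi_term_transfer[OF lam F] by blast
  show lip: "\<exists>L. L-lipschitz_on UNIV (\<lambda>u. Phi lam e F u y)"
    by (rule Phi_lipschitz[OF lam F])
  then obtain L where L: "L-lipschitz_on UNIV (\<lambda>u. Phi lam e F u y)"
    by blast
  have L0: "0 \<le> L"
    by (rule lipschitz_on_nonneg[OF L])
  \<comment> \<open>The global constant may be 0, so 1 is added to make it strictly
    positive.\<close>
  show "\<exists>L>0. L-lipschitz_on (ball 0 r) (\<lambda>u. Phi lam e F u y)" for r
    using L0 by (intro exI[of _ "L + 1"] conjI lipschitz_on_mono[OF L]) auto
  have "Phi lam e F 0 y - L * norm u \<le> Phi lam e F u y" for u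
    using lipschitz_onD[OF L, of 0 u] by (auto simp: dist_norm)
  then show "\<exists>L\<ge>0. \<forall>u. Phi lam e F u y \<ge> Phi lam e F 0 y - L * norm u"
    using L0 by blast
qed

end
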